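(* Let $n\ge 2$ and $m=n-1$. There exist a real number $\mu$ and a nontrivial self-adjoint $n\times n$ matrix $Q$ in standard form, with zero diagonal and off-diagonal entries that are cube roots of unity, such that $Q^2=(n-1)I+\mu Q$, if and only if for some integer $e>0$ there exists a non-empty $e$-regular directed graph on $m$ vertices such that: (1) for each pair of vertices $v,w$ with a directed edge from $v$ to $w$, the associated counts satisfy $$\alpha-B=\tfrac{6e+1-2m}{3},\quad \beta-C_1=\tfrac{6e-2m+1}{3},\quad \gamma+B+C_1=\tfrac{4m-9e-5}{3},\quad a-C_1=\tfrac{3e-m+2}{3},$$ $$b+B+C_1=\tfrac{2m-3e-4}{3},\quad c-B=\tfrac{3e-m+2}{3},\quad A+B+C_1=m-2e-1;$$ (2) for each pair of distinct vertices $v,w$ with no edge between them, the associated counts satisfy $$\alpha'=B',\quad \beta'=C_1'+3e+2-m,\quad \gamma'=m-2e-2-B'-C_1',\quad a'=C_1'+3e+2-m,$$ $$b'=m-2e-2-B'-C_1',\quad c'=B',\quad A'=m-2e-2-B'-C_1'.$$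
   Context: A matrix with zero diagonal and unimodular off-diagonal entries is in standard form if all entries of its first row and first column, except the diagonal one, equal $1$. A matrix in standard form is nontrivial if at least one off-diagonal entry is not equal to $1$. Directed graphs have no loops and at most one directed edge between any two distinct vertices (so never both $v\to w$ and $w\to v$). Write $v\to w$ if there is a directed edge from $v$ to $w$, and $v\wr w$ if there is no directed edge in either direction between $v$ and $w$. A directed graph is $e$-regular if each vertex emits exactly $e$ directed edges and receives exactly $e$ directed edges. Counts: let $V$ be the vertex set. For an ordered pair $v\ne w$ with $v\to w$, counting only $u\in V\setminus\{v,w\}$, set $\alpha=\#\{u: v\to u, w\to u\}$, $\beta=\#\{u: v\to u, u\to w\}$, $\gamma=\#\{u: v\to u, u\wr w\}$, $a=\#\{u: u\to v, w\to u\}$, $b=\#\{u: u\to v, u\to w\}$, $c=\#\{u: u\to v, u\wr w\}$, $A=\#\{u: u\wr v, w\to u\}$, $B=\#\{u: u\wr v, u\to w\}$, $C_1=\#\{u: u\wr v, u\wr w\}$. For an ordered pair $v\ne w$ with $v\wr w$, the numbers $\alpha',\beta',\gamma',a',b',c',A',B',C_1'$ are defined by the same nine formulas, respectively. All counts depend on the pair $(v,w)$. *)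

theory Defs
  imports
    "Jordan_Normal_Form.Schur_Decomposition"
    "Graph_Theory.Pair_Digraph"
begin

section \<open>Matrices in standard form\<close>

definition zero_diagonal :: "complex mat \<Rightarrow> bool" where
  "zero_diagonal Q \<longleftrightarrow> (\<forall>i<dim_row Q. Q $$ (i, i) = 0)"

definition unimodular_off_diagonal :: "complex mat \<Rightarrow> bool" where
  "unimodular_off_diagonal Q \<longleftrightarrow>
     (\<forall>i<dim_row Q. \<forall>j<dim_col Q. i \<noteq> j \<longrightarrow> cmod (Q $$ (i, j)) = 1)"

text \<open>Rows and columns are indexed from 0, so the first row and column have index 0.\<close>

definition standard_form :: "complex mat \<Rightarrow> bool" where
  "standard_form Q \<longleftrightarrow>
     square_mat Q \<and> zero_diagonal Q \<and> unimodular_off_diagonal Q \<and>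
     (\<forall>j<dim_col Q. j \<noteq> 0 \<longrightarrow> Q $$ (0, j) = 1) \<and>
     (\<forall>i<dim_row Q. i \<noteq> 0 \<longrightarrow> Q $$ (i, 0) = 1)"

definition nontrivial :: "complex mat \<Rightarrow> bool" where
  "nontrivial Q \<longleftrightarrow> (\<exists>i<dim_row Q. \<exists>j<dim_col Q. i \<noteq> j \<and> Q $$ (i, j) \<noteq> 1)"

definition self_adjoint :: "complex mat \<Rightarrow> bool" where
  "self_adjoint Q \<longleftrightarrow> mat_adjoint Q = Q"

definition cube_root_off_diagonal :: "complex mat \<Rightarrow> bool" where
  "cube_root_off_diagonal Q \<longleftrightarrow>
     (\<forall>i<dim_row Q. \<forall>j<dim_col Q. i \<noteq> j \<longrightarrow> (Q $$ (i, j)) ^ 3 = 1)"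


section \<open>Directed graphs\<close>

locale oriented_digraph = pair_digraph +
  assumes no_opposite_arcs: "(v, w) \<in> parcs G \<Longrightarrow> (w, v) \<notin> parcs G"

definition regular_digraph :: "nat \<Rightarrow> 'a pair_pre_digraph \<Rightarrow> bool" where
  "regular_digraph e G \<longleftrightarrow> (\<forall>v\<in>pverts G. out_degree G v = e \<and> in_degree G v = e)"

definition no_edge :: "'a pair_pre_digraph \<Rightarrow> 'a \<Rightarrow> 'a \<Rightarrow> bool" where
  "no_edge G v w \<longleftrightarrow> \<not> v \<rightarrow>\<^bsub>G\<^esub> w \<and> \<not> w \<rightarrow>\<^bsub>G\<^esub> v"

text \<open>
  The nine counts of an ordered pair of distinct vertices. The primed counts of a
  non-adjacent pair are given by the same formulas, hence by the same functions.
\<close>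

definition cnt_alpha :: "'a pair_pre_digraph \<Rightarrow> 'a \<Rightarrow> 'a \<Rightarrow> nat" where
  "cnt_alpha G v w = card {u \<in> pverts G - {v, w}. v \<rightarrow>\<^bsub>G\<^esub> u \<and> w \<rightarrow>\<^bsub>G\<^esub> u}"

definition cnt_beta :: "'a pair_pre_digraph \<Rightarrow> 'a \<Rightarrow> 'a \<Rightarrow> nat" where
  "cnt_beta G v w = card {u \<in> pverts G - {v, w}. v \<rightarrow>\<^bsub>G\<^esub> u \<and> u \<rightarrow>\<^bsub>G\<^esub> w}"

definition cnt_gamma :: "'a pair_pre_digraph \<Rightarrow> 'a \<Rightarrow> 'a \<Rightarrow> nat" where
  "cnt_gamma G v w = card {u \<in> pverts G - {v, w}. v \<rightarrow>\<^bsub>G\<^esub> u \<and> no_edge G u w}"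

definition cnt_a :: "'a pair_pre_digraph \<Rightarrow> 'a \<Rightarrow> 'a \<Rightarrow> nat" where
  "cnt_a G v w = card {u \<in> pverts G - {v, w}. u \<rightarrow>\<^bsub>G\<^esub> v \<and> w \<rightarrow>\<^bsub>G\<^esub> u}"

definition cnt_b :: "'a pair_pre_digraph \<Rightarrow> 'a \<Rightarrow> 'a \<Rightarrow> nat" where
  "cnt_b G v w = card {u \<in> pverts G - {v, w}. u \<rightarrow>\<^bsub>G\<^esub> v \<and> u \<rightarrow>\<^bsub>G\<^esub> w}"

definition cnt_c :: "'a pair_pre_digraph \<Rightarrow> 'a \<Rightarrow> 'a \<Rightarrow> nat" where
  "cnt_c G v w = card {u \<in> pverts G - {v, w}. u \<rightarrow>\<^bsub>G\<^esub> v \<and> no_edge G u w}"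

definition cnt_A :: "'a pair_pre_digraph \<Rightarrow> 'a \<Rightarrow> 'a \<Rightarrow> nat" where
  "cnt_A G v w = card {u \<in> pverts G - {v, w}. no_edge G u v \<and> w \<rightarrow>\<^bsub>G\<^esub> u}"

definition cnt_B :: "'a pair_pre_digraph \<Rightarrow> 'a \<Rightarrow> 'a \<Rightarrow> nat" where
  "cnt_B G v w = card {u \<in> pverts G - {v, w}. no_edge G u v \<and> u \<rightarrow>\<^bsub>G\<^esub> w}"

definition cnt_C1 :: "'a pair_pre_digraph \<Rightarrow> 'a \<Rightarrow> 'a \<Rightarrow> nat" where
  "cnt_C1 G v w = card {u \<in> pverts G - {v, w}. no_edge G u v \<and> no_edge G u w}"

end

theory Submission
  imports Defs
begin

text \<open>
  Deleting the first row and column of \<open>Q\<close> leaves a Hermitian matrix with entries \<open>1\<close>, \<open>\<omega>\<close>, \<open>\<omega>\<^sup>2\<close>,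
  which encodes an oriented graph by \<open>v \<rightarrow> w\<close> iff the entry at \<open>(v, w)\<close> is \<open>\<omega>\<close>. As \<open>1\<close>, \<open>\<omega>\<close>, \<open>\<omega>\<^sup>2\<close>
  satisfy only the real linear relations \<open>x = y = z\<close>, each entry of the matrix equation says that
  certain numbers of vertices agree. The first row and column give in-degree = out-degree \<open>= e\<close>
  with \<open>\<mu> = m - 1 - 3 e\<close>; an entry \<open>(v, w)\<close> with \<open>v \<noteq> w\<close> fixes the three sums \<open>\<alpha> + b + C\<^sub>1\<close>,
  \<open>\<gamma> + a + B\<close>, \<open>\<beta> + c + A\<close>. Given the row and column sums that regularity imposes on the
  \<open>3 \<times> 3\<close> array of counts, this is linearly equivalent to the stated equations. The diagonal
  entries hold automatically.
\<close>

section \<open>Cube roots of unity\<close>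

text \<open>The primitive cube root exp(2 pi i / 3), in coordinates so that identities split into
  real and imaginary parts. The other primitive root, its square and conjugate, is written
  \<open>- 1 - \<omega>\<close>, which keeps expressions linear in \<open>\<omega>\<close>.\<close>

definition \<omega> :: complex where
  "\<omega> = Complex (- 1 / 2) (sqrt 3 / 2)"

lemma omega_square: "\<omega>\<^sup>2 = - 1 - \<omega>"
  by (simp add: \<omega>_def complex_eq_iff power2_eq_square)

lemma omega_times_omega: "\<omega> * \<omega> = - 1 - \<omega>"
  using omega_square by (simp add: power2_eq_square)

lemma cnj_omega: "cnj \<omega> = - 1 - \<omega>"
  by (simp add: \<omega>_def complex_eq_iff)

lemma omega_neq: "\<omega> \<noteq> 0" "\<omega> \<noteq> 1" "\<omega> \<noteq> - 1 - \<omega>" "- 1 - \<omega> \<noteq> 1"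
  by (simp_all add: \<omega>_def complex_eq_iff)

lemma omega_cube: "\<omega> ^ 3 = 1" "(- 1 - \<omega>) ^ 3 = 1"
proof -
  have cube: "x ^ 3 = x * x * x" for x :: complex
    by (simp add: power3_eq_cube)
  \<comment> \<open>Expanding the cubes leaves right-nested products of square roots, which the
    usual rule for \<open>sqrt 3 * sqrt 3\<close> does not match.\<close>
  have [simp]: "sqrt 3 * (sqrt 3 * x) = 3 * x" for x :: real
    by (metis mult.assoc real_sqrt_mult_self abs_numeral)
  show "\<omega> ^ 3 = 1" "(- 1 - \<omega>) ^ 3 = 1"
    by (simp_all add: cube \<omega>_def complex_eq_iff algebra_simps)
qed

lemma cube_root_of_unity_cases:
  fixes z :: complex
  assumes "z ^ 3 = 1"
  shows "z = 1 \<or> z = \<omega> \<or> z = - 1 - \<omega>"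
proof -
  have "(z - 1) * ((z - \<omega>) * (z - (- 1 - \<omega>))) = (z - 1) * (z\<^sup>2 + z - (\<omega> + \<omega> * \<omega>))"
    by (simp add: algebra_simps power2_eq_square)
  \<comment> \<open>The quadratic factor is \<open>z\<^sup>2 + z + 1\<close>, because
    \<open>\<omega> + \<omega> * \<omega> = - 1\<close>.\<close>
  also have "\<dots> = z ^ 3 - 1"
    by (simp add: omega_times_omega algebra_simps power2_eq_square power3_eq_cube)
  finally have "(z - 1) * ((z - \<omega>) * (z - (- 1 - \<omega>))) = 0"
    using assms by simp
  then show ?thesis
    by auto
qed

text \<open>Over the reals the only relation among the three roots, up to scaling, is that their sum
  is 0. The imaginary part forces \<open>y = z\<close>, and the real part then gives
  \<open>x = y\<close>.\<close>

lemma real_combination_eq_0_iff: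
  fixes x y z :: real
  shows "of_real x + \<omega> * of_real y + (- 1 - \<omega>) * of_real z = 0 \<longleftrightarrow> x = y \<and> y = z"
proof -
  have "sqrt 3 * y = sqrt 3 * z \<longleftrightarrow> y = z"
    by simp
  then show ?thesis
    unfolding \<omega>_def complex_eq_iff by (auto simp: field_simps)
qed


section \<open>The weights of an oriented graph\<close>

definition weight :: "'a pair_pre_digraph \<Rightarrow> 'a \<Rightarrow> 'a \<Rightarrow> complex" where
  "weight G v w =
     (if v = w then 0 else if v \<rightarrow>\<^bsub>G\<^esub> w then \<omega> else if w \<rightarrow>\<^bsub>G\<^esub> v then - 1 - \<omega> else 1)"

text \<open>The matrix equation off the diagonal: the column sums come from the bordering row, and
  the summand 1 in the second condition is the contribution of the bordering index to an inner
  entry.\<close>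

definition quadratic_weights :: "'a pair_pre_digraph \<Rightarrow> real \<Rightarrow> bool" where
  "quadratic_weights G \<mu> \<longleftrightarrow>
     (\<forall>w\<in>pverts G. (\<Sum>u\<in>pverts G. weight G u w) = of_real \<mu>) \<and>
     (\<forall>v\<in>pverts G. \<forall>w\<in>pverts G. v \<noteq> w \<longrightarrow>
        1 + (\<Sum>u\<in>pverts G. weight G v u * weight G u w) = of_real \<mu> * weight G v w)"

definition arc_counts :: "nat \<Rightarrow> nat \<Rightarrow> 'a pair_pre_digraph \<Rightarrow> 'a \<Rightarrow> 'a \<Rightarrow> bool" where
  "arc_counts e m G v w \<longleftrightarrow>
     real (cnt_alpha G v w) - real (cnt_B G v w) = (6 * real e + 1 - 2 * real m) / 3 \<and>
     real (cnt_beta G v w) - real (cnt_C1 G v w) = (6 * real e - 2 * real m + 1) / 3 \<and>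
     real (cnt_gamma G v w) + real (cnt_B G v w) + real (cnt_C1 G v w) = (4 * real m - 9 * real e - 5) / 3 \<and>
     real (cnt_a G v w) - real (cnt_C1 G v w) = (3 * real e - real m + 2) / 3 \<and>
     real (cnt_b G v w) + real (cnt_B G v w) + real (cnt_C1 G v w) = (2 * real m - 3 * real e - 4) / 3 \<and>
     real (cnt_c G v w) - real (cnt_B G v w) = (3 * real e - real m + 2) / 3 \<and>
     real (cnt_A G v w) + real (cnt_B G v w) + real (cnt_C1 G v w) = real m - 2 * real e - 1"

definition non_arc_counts :: "nat \<Rightarrow> nat \<Rightarrow> 'a pair_pre_digraph \<Rightarrow> 'a \<Rightarrow> 'a \<Rightarrow> bool" where
  "non_arc_counts e m G v w \<longleftrightarrow>
     real (cnt_alpha G v w) = real (cnt_B G v w) \<and>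
     real (cnt_beta G v w) = real (cnt_C1 G v w) + 3 * real e + 2 - real m \<and>
     real (cnt_gamma G v w) = real m - 2 * real e - 2 - real (cnt_B G v w) - real (cnt_C1 G v w) \<and>
     real (cnt_a G v w) = real (cnt_C1 G v w) + 3 * real e + 2 - real m \<and>
     real (cnt_b G v w) = real m - 2 * real e - 2 - real (cnt_B G v w) - real (cnt_C1 G v w) \<and>
     real (cnt_c G v w) = real (cnt_B G v w) \<and>
     real (cnt_A G v w) = real m - 2 * real e - 2 - real (cnt_B G v w) - real (cnt_C1 G v w)"

section \<open>Degrees and counts as sums of indicators\<close>

lemma of_nat_card_filter:
  "finite S \<Longrightarrow> of_nat (card {u \<in> S. P u}) = (\<Sum>u\<in>S. if P u then 1 else 0 :: 'b :: semiring_1)"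
  by (simp flip: sum.inter_filter)

context oriented_digraph
begin

lemma arc_neq: "v \<rightarrow>\<^bsub>G\<^esub> w \<Longrightarrow> v \<noteq> w"
  using pair_no_loops by fastforce

text \<open>Rests on the absence of opposite arcs: with both arcs present, both weights would be
  \<open>\<omega>\<close>, which is not its own conjugate.\<close>

lemma cnj_weight: "cnj (weight G v w) = weight G w v"
  using no_opposite_arcs by (auto simp: weight_def cnj_omega)

lemma real_out_degree:
  "real (out_degree G v) = (\<Sum>u\<in>pverts G. if v \<rightarrow>\<^bsub>G\<^esub> u then 1 else 0)"
proof -
  have "out_arcs G v = Pair v ` {u \<in> pverts G. v \<rightarrow>\<^bsub>G\<^esub> u}"
    using in_arcsD2 by (auto simp: out_arcs_def)
  then have "out_degree G v = card {u \<in> pverts G. v \<rightarrow>\<^bsub>G\<^esub> u}"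
    unfolding out_degree_def by (simp add: card_image inj_on_def)
  then show ?thesis
    by (simp only: of_nat_card_filter pair_finite_verts)
qed

lemma real_in_degree:
  "real (in_degree G v) = (\<Sum>u\<in>pverts G. if u \<rightarrow>\<^bsub>G\<^esub> v then 1 else 0)"
proof -
  have "in_arcs G v = (\<lambda>u. (u, v)) ` {u \<in> pverts G. u \<rightarrow>\<^bsub>G\<^esub> v}"
    using in_arcsD1 by (auto simp: in_arcs_def)
  then have "in_degree G v = card {u \<in> pverts G. u \<rightarrow>\<^bsub>G\<^esub> v}"
    unfolding in_degree_def by (simp add: card_image inj_on_def)
  then show ?thesis
    by (simp only: of_nat_card_filter pair_finite_verts)
qed

lemma sum_weight:
  assumes "w \<in> pverts G"
  shows "(\<Sum>u\<in>pverts G. weight G u w) =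
    of_real (real (card (pverts G)) - 1 - real (in_degree G w) - real (out_degree G w)) +
    \<omega> * of_real (real (in_degree G w)) + (- 1 - \<omega>) * of_real (real (out_degree G w))"
proof -
  \<comment> \<open>The three indicators exclude each other. The one for \<open>u = w\<close>
    cancels the constant 1 and so produces the zero diagonal.\<close>
  have "(\<Sum>u\<in>pverts G. weight G u w) =
     (\<Sum>u\<in>pverts G. of_real (1 - (if u = w then 1 else 0) - (if u \<rightarrow>\<^bsub>G\<^esub> w then 1 else 0)
                                - (if w \<rightarrow>\<^bsub>G\<^esub> u then 1 else 0))
       + \<omega> * of_real (if u \<rightarrow>\<^bsub>G\<^esub> w then 1 else 0)
       + (- 1 - \<omega>) * of_real (if w \<rightarrow>\<^bsub>G\<^esub> u then 1 else 0))"
    using no_opposite_arcs arc_neq by (intro sum.cong) (auto simp: weight_def)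
  also have "\<dots> = of_real ((\<Sum>u\<in>pverts G. 1) - (\<Sum>u\<in>pverts G. if u = w then 1 else 0)
        - real (in_degree G w) - real (out_degree G w))
       + \<omega> * of_real (real (in_degree G w)) + (- 1 - \<omega>) * of_real (real (out_degree G w))"
    unfolding real_in_degree real_out_degree sum.distrib of_real_sum sum_distrib_left[symmetric]
      sum_subtractf of_real_diff ..
  finally show ?thesis
    using assms pair_finite_verts by simp
qed

text \<open>Hands the exclusion of opposite arcs to the summandwise comparison, which then reduces
  to a case analysis on the arcs between \<open>u\<close> and the two fixed vertices.\<close>

lemma sum_arc_cong:
  assumes "\<And>u. u \<in> S \<Longrightarrow> \<not> (v \<rightarrow>\<^bsub>G\<^esub> u \<and> u \<rightarrow>\<^bsub>G\<^esub> v) \<Longrightarrow> \<not> (w \<rightarrow>\<^bsub>G\<^esub> u \<and> u \<rightarrow>\<^bsub>G\<^esub> w) \<Longrightarrow> f u = g u"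
  shows "sum f S = sum g S"
  using no_opposite_arcs by (intro sum.cong refl assms) auto

text \<open>Exponents of \<open>\<omega>\<close> add modulo 3. Each \<open>u\<close> other than
  \<open>v\<close> and \<open>w\<close> lies in exactly one of nine classes, and these group by
  threes according to whether the product is 1, \<open>\<omega>\<close> or
  \<open>\<omega>\<^sup>2\<close>.\<close>

lemma sum_weight_mult:
  assumes "v \<in> pverts G" "w \<in> pverts G" "v \<noteq> w"
  shows "(\<Sum>u\<in>pverts G. weight G v u * weight G u w) =
    of_real (real (cnt_alpha G v w) + real (cnt_b G v w) + real (cnt_C1 G v w)) +
    \<omega> * of_real (real (cnt_gamma G v w) + real (cnt_a G v w) + real (cnt_B G v w)) +
    (- 1 - \<omega>) * of_real (real (cnt_beta G v w) + real (cnt_c G v w) + real (cnt_A G v w))"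
proof -
  have fin: "finite (pverts G - {v, w})"
    using pair_finite_verts by simp
  have prod: "(- 1 - \<omega>) * (- 1 - \<omega>) = \<omega>" "\<omega> * (- 1 - \<omega>) = 1" "(- 1 - \<omega>) * \<omega> = 1"
    by (simp_all add: algebra_simps omega_times_omega)
  \<comment> \<open>The terms \<open>u = v\<close> and \<open>u = w\<close> contain a diagonal
    weight and vanish, in agreement with the range of the counts.\<close>
  have "(\<Sum>u\<in>pverts G. weight G v u * weight G u w) =
      (\<Sum>u\<in>pverts G - {v, w}. weight G v u * weight G u w)"
    by (rule sum.mono_neutral_right) (use pair_finite_verts in \<open>auto simp: weight_def\<close>)
  also have "\<dots> = (\<Sum>u\<in>pverts G - {v, w}.
      of_real ((if v \<rightarrow>\<^bsub>G\<^esub> u \<and> w \<rightarrow>\<^bsub>G\<^esub> u then 1 else 0) + (if u \<rightarrow>\<^bsub>G\<^esub> v \<and> u \<rightarrow>\<^bsub>G\<^esub> w then 1 else 0)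
         + (if no_edge G u v \<and> no_edge G u w then 1 else 0)) +
      \<omega> * of_real ((if v \<rightarrow>\<^bsub>G\<^esub> u \<and> no_edge G u w then 1 else 0)
         + (if u \<rightarrow>\<^bsub>G\<^esub> v \<and> w \<rightarrow>\<^bsub>G\<^esub> u then 1 else 0) + (if no_edge G u v \<and> u \<rightarrow>\<^bsub>G\<^esub> w then 1 else 0)) +
      (- 1 - \<omega>) * of_real ((if v \<rightarrow>\<^bsub>G\<^esub> u \<and> u \<rightarrow>\<^bsub>G\<^esub> w then 1 else 0)
         + (if u \<rightarrow>\<^bsub>G\<^esub> v \<and> no_edge G u w then 1 else 0) + (if no_edge G u v \<and> w \<rightarrow>\<^bsub>G\<^esub> u then 1 else 0)))"
    by (rule sum_arc_cong[of _ v w]) (auto simp: weight_def no_edge_def omega_times_omega prod)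
  also have "\<dots> = of_real (real (cnt_alpha G v w) + real (cnt_b G v w) + real (cnt_C1 G v w)) +
    \<omega> * of_real (real (cnt_gamma G v w) + real (cnt_a G v w) + real (cnt_B G v w)) +
    (- 1 - \<omega>) * of_real (real (cnt_beta G v w) + real (cnt_c G v w) + real (cnt_A G v w))"
    unfolding cnt_alpha_def cnt_beta_def cnt_gamma_def cnt_a_def cnt_b_def cnt_c_def cnt_A_def
      cnt_B_def cnt_C1_def of_nat_card_filter[OF fin] sum.distrib of_real_sum of_real_add
      sum_distrib_left[symmetric] ..
  finally show ?thesis .
qed

text \<open>Row sums, column sums and the total of the array of nine counts. A degree exceeds the
  corresponding sum by 1 exactly when the counted arc joins \<open>v\<close> and \<open>w\<close>
  themselves, since the counts leave these vertices out; \<open>vw\<close> and \<open>wv\<close>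
  correct for this.\<close>

lemma regular_cnt:
  assumes "regular_digraph e G" "v \<in> pverts G" "w \<in> pverts G" "v \<noteq> w"
  defines "vw \<equiv> if v \<rightarrow>\<^bsub>G\<^esub> w then 1 else 0 :: real"
  defines "wv \<equiv> if w \<rightarrow>\<^bsub>G\<^esub> v then 1 else 0 :: real"
  shows "real (cnt_alpha G v w) + real (cnt_beta G v w) + real (cnt_gamma G v w) = real e - vw"
    and "real (cnt_a G v w) + real (cnt_b G v w) + real (cnt_c G v w) = real e - wv"
    and "real (cnt_alpha G v w) + real (cnt_a G v w) + real (cnt_A G v w) = real e - wv"
    and "real (cnt_beta G v w) + real (cnt_b G v w) + real (cnt_B G v w) = real e - vw"
    and "real (cnt_alpha G v w) + real (cnt_beta G v w) + real (cnt_gamma G v w) +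
         real (cnt_a G v w) + real (cnt_b G v w) + real (cnt_c G v w) +
         real (cnt_A G v w) + real (cnt_B G v w) + real (cnt_C1 G v w) = real (card (pverts G)) - 2"
proof -
  let ?S = "pverts G - {v, w}"
  have fin: "finite ?S"
    using pair_finite_verts by simp
  have deg: "real (out_degree G v) = real e" "real (in_degree G v) = real e"
    "real (out_degree G w) = real e" "real (in_degree G w) = real e"
    using assms by (auto simp: regular_digraph_def)
  have irrefl: "(u, u) \<notin> parcs G" for u
    using arc_neq by auto
  \<comment> \<open>Of the two terms split off from a degree sum, one is a loop and vanishes by
    \<open>irrefl\<close>; the other is \<open>vw\<close> or \<open>wv\<close>.\<close>
  have split: "sum f (pverts G) = sum f ?S + f v + f w" for f :: "'a \<Rightarrow> real"
    using pair_finite_verts assms(2-4)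
    by (simp add: sum.remove[of "pverts G" v] sum.remove[of "pverts G - {v}" w] Diff_insert2[symmetric]
        insert_commute flip: Diff_insert)
  note card = cnt_alpha_def cnt_beta_def cnt_gamma_def cnt_a_def cnt_b_def cnt_c_def cnt_A_def
      cnt_B_def cnt_C1_def of_nat_card_filter[OF fin]
  have "real (cnt_alpha G v w) + real (cnt_beta G v w) + real (cnt_gamma G v w) =
      (\<Sum>u\<in>?S. if v \<rightarrow>\<^bsub>G\<^esub> u then 1 else 0)"
    unfolding card sum.distrib[symmetric]
    by (rule sum_arc_cong[of _ v w]) (auto simp: no_edge_def)
  then show "real (cnt_alpha G v w) + real (cnt_beta G v w) + real (cnt_gamma G v w) = real e - vw"
    using deg(1) by (simp add: real_out_degree split irrefl vw_def)
  have "real (cnt_a G v w) + real (cnt_b G v w) + real (cnt_c G v w) =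
      (\<Sum>u\<in>?S. if u \<rightarrow>\<^bsub>G\<^esub> v then 1 else 0)"
    unfolding card sum.distrib[symmetric]
    by (rule sum_arc_cong[of _ v w]) (auto simp: no_edge_def)
  then show "real (cnt_a G v w) + real (cnt_b G v w) + real (cnt_c G v w) = real e - wv"
    using deg(2) by (simp add: real_in_degree split irrefl wv_def)
  have "real (cnt_alpha G v w) + real (cnt_a G v w) + real (cnt_A G v w) =
      (\<Sum>u\<in>?S. if w \<rightarrow>\<^bsub>G\<^esub> u then 1 else 0)"
    unfolding card sum.distrib[symmetric]
    by (rule sum_arc_cong[of _ v w]) (auto simp: no_edge_def)
  then show "real (cnt_alpha G v w) + real (cnt_a G v w) + real (cnt_A G v w) = real e - wv"
    using deg(3) by (simp add: real_out_degree split irrefl wv_def)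
  have "real (cnt_beta G v w) + real (cnt_b G v w) + real (cnt_B G v w) =
      (\<Sum>u\<in>?S. if u \<rightarrow>\<^bsub>G\<^esub> w then 1 else 0)"
    unfolding card sum.distrib[symmetric]
    by (rule sum_arc_cong[of _ v w]) (auto simp: no_edge_def)
  then show "real (cnt_beta G v w) + real (cnt_b G v w) + real (cnt_B G v w) = real e - vw"
    using deg(4) by (simp add: real_in_degree split irrefl vw_def)
  have "real (cnt_alpha G v w) + real (cnt_beta G v w) + real (cnt_gamma G v w) +
         real (cnt_a G v w) + real (cnt_b G v w) + real (cnt_c G v w) +
         real (cnt_A G v w) + real (cnt_B G v w) + real (cnt_C1 G v w) = (\<Sum>u\<in>?S. 1)"
    unfolding card sum.distrib[symmetric]
    by (rule sum_arc_cong[of _ v w]) (auto simp: no_edge_def)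
  also have "\<dots> = (\<Sum>u\<in>pverts G. 1) - 2"
    unfolding split by simp
  finally show "real (cnt_alpha G v w) + real (cnt_beta G v w) + real (cnt_gamma G v w) +
         real (cnt_a G v w) + real (cnt_b G v w) + real (cnt_c G v w) +
         real (cnt_A G v w) + real (cnt_B G v w) + real (cnt_C1 G v w) = real (card (pverts G)) - 2"
    by simp
qed

section \<open>From complex identities to equations between counts\<close>

text \<open>Subtracting \<mu> changes only the coefficient of 1. Equality of the three real
  coefficients then balances the degrees and expresses \<mu> through them.\<close>

lemma sum_weight_eq_iff:
  assumes "w \<in> pverts G"
  shows "(\<Sum>u\<in>pverts G. weight G u w) = of_real \<mu> \<longleftrightarrow>
    in_degree G w = out_degree G w \<and> \<mu> = real (card (pverts G)) - 1 - 3 * real (out_degree G w)"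
proof -
  let ?i = "real (in_degree G w)" and ?o = "real (out_degree G w)" and ?m = "real (card (pverts G))"
  have "(\<Sum>u\<in>pverts G. weight G u w) = of_real \<mu> \<longleftrightarrow>
      of_real (?m - 1 - ?i - ?o - \<mu>) + \<omega> * of_real ?i + (- 1 - \<omega>) * of_real ?o = 0"
    unfolding sum_weight[OF assms] by (simp add: algebra_simps)
  then show ?thesis
    unfolding real_combination_eq_0_iff by auto
qed

text \<open>On the right-hand side only the coefficient of \<open>\<omega>\<close> is present, so
  the condition is \<open>1 + X = Y - \<mu> = Z\<close> for the three grouped sums. These two
  equations and the five of \<open>regular_cnt\<close> express seven counts through
  \<open>cnt_B\<close> and \<open>cnt_C1\<close>, which stay free.\<close>

lemma weight_mult_arc_iff:
  assumes reg: "regular_digraph e G" and arc: "v \<rightarrow>\<^bsub>G\<^esub> w" and m: "m = card (pverts G)"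
  shows "1 + (\<Sum>u\<in>pverts G. weight G v u * weight G u w)
      = of_real (real m - 1 - 3 * real e) * weight G v w \<longleftrightarrow> arc_counts e m G v w"
proof -
  have vw: "v \<in> pverts G" "w \<in> pverts G" "v \<noteq> w" "\<not> w \<rightarrow>\<^bsub>G\<^esub> v"
    using arc in_arcsD1[of v w] in_arcsD2[of v w] arc_neq[of v w] no_opposite_arcs[of v w] by simp_all
  let ?X = "real (cnt_alpha G v w) + real (cnt_b G v w) + real (cnt_C1 G v w)"
  let ?Y = "real (cnt_gamma G v w) + real (cnt_a G v w) + real (cnt_B G v w)"
  let ?Z = "real (cnt_beta G v w) + real (cnt_c G v w) + real (cnt_A G v w)"
  have "1 + (\<Sum>u\<in>pverts G. weight G v u * weight G u w)
        = of_real (real m - 1 - 3 * real e) * weight G v w \<longleftrightarrow>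
      of_real (1 + ?X) + \<omega> * of_real (?Y - (real m - 1 - 3 * real e)) + (- 1 - \<omega>) * of_real ?Z = 0"
    unfolding sum_weight_mult[OF vw(1-3)] using arc vw by (simp add: weight_def algebra_simps)
  also have "\<dots> \<longleftrightarrow> arc_counts e m G v w"
    unfolding real_combination_eq_0_iff arc_counts_def
    using regular_cnt[OF reg vw(1-3)] arc vw(4) unfolding m by (simp del: of_nat_eq_iff) argo
  finally show ?thesis .
qed

text \<open>Here the weight of the pair is 1, so \<mu> enters the coefficient of 1 instead, and the
  condition is \<open>1 + X - \<mu> = Y = Z\<close>. The elimination is otherwise that for
  arcs.\<close>

lemma weight_mult_non_arc_iff:
  assumes reg: "regular_digraph e G" and vw: "v \<in> pverts G" "w \<in> pverts G" "v \<noteq> w"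
    and non_arc: "no_edge G v w" and m: "m = card (pverts G)"
  shows "1 + (\<Sum>u\<in>pverts G. weight G v u * weight G u w)
      = of_real (real m - 1 - 3 * real e) * weight G v w \<longleftrightarrow> non_arc_counts e m G v w"
proof -
  let ?X = "real (cnt_alpha G v w) + real (cnt_b G v w) + real (cnt_C1 G v w)"
  let ?Y = "real (cnt_gamma G v w) + real (cnt_a G v w) + real (cnt_B G v w)"
  let ?Z = "real (cnt_beta G v w) + real (cnt_c G v w) + real (cnt_A G v w)"
  have "1 + (\<Sum>u\<in>pverts G. weight G v u * weight G u w)
        = of_real (real m - 1 - 3 * real e) * weight G v w \<longleftrightarrow>
      of_real (1 + ?X - (real m - 1 - 3 * real e)) + \<omega> * of_real ?Y + (- 1 - \<omega>) * of_real ?Z = 0"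
    unfolding sum_weight_mult[OF vw] using non_arc vw
    by (simp add: weight_def no_edge_def algebra_simps)
  also have "\<dots> \<longleftrightarrow> non_arc_counts e m G v w"
    unfolding real_combination_eq_0_iff non_arc_counts_def
    using regular_cnt[OF reg vw] non_arc unfolding m no_edge_def by (simp del: of_nat_eq_iff) argo
  finally show ?thesis .
qed

text \<open>Conjugation, with \<mu> real. It allows the arc equations to be imposed only on pairs
  ordered along the arc.\<close>

lemma weight_mult_swap:
  assumes "1 + (\<Sum>u\<in>pverts G. weight G v u * weight G u w) = of_real \<mu> * weight G v w"
  shows "1 + (\<Sum>u\<in>pverts G. weight G w u * weight G u v) = of_real \<mu> * weight G w v"
  using arg_cong[OF assms, of cnj] by (simp add: cnj_weight mult.commute)

lemma quadratic_weights_iff: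
  assumes m: "m = card (pverts G)" and "pverts G \<noteq> {}"
  shows "(\<exists>\<mu>. quadratic_weights G \<mu>) \<longleftrightarrow>
    (\<exists>e. regular_digraph e G \<and>
       (\<forall>v\<in>pverts G. \<forall>w\<in>pverts G. v \<rightarrow>\<^bsub>G\<^esub> w \<longrightarrow> arc_counts e m G v w) \<and>
       (\<forall>v\<in>pverts G. \<forall>w\<in>pverts G. v \<noteq> w \<and> no_edge G v w \<longrightarrow> non_arc_counts e m G v w))"
    (is "?L \<longleftrightarrow> (\<exists>e. ?R e)")
proof
  assume ?L
  then obtain \<mu> where \<mu>: "quadratic_weights G \<mu>" ..
  obtain v0 where v0: "v0 \<in> pverts G"
    using assms by blast
  \<comment> \<open>Any vertex will do: \<mu> determines the out-degree, so all vertices share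
    it.\<close>
  define e where "e = out_degree G v0"
  have deg: "in_degree G w = out_degree G w \<and> \<mu> = real m - 1 - 3 * real (out_degree G w)"
    if "w \<in> pverts G" for w
    using \<mu> sum_weight_eq_iff[OF that, of \<mu>] that by (auto simp: quadratic_weights_def m)
  have \<mu>_eq: "\<mu> = real m - 1 - 3 * real e"
    using deg[OF v0] by (simp add: e_def)
  have reg: "regular_digraph e G"
    using deg \<mu>_eq by (fastforce simp: regular_digraph_def)
  moreover have "arc_counts e m G v w" if "v \<rightarrow>\<^bsub>G\<^esub> w" for v w
    using \<mu> weight_mult_arc_iff[OF reg that m] in_arcsD1[of v w] in_arcsD2[of v w] arc_neq[OF that] that
    by (simp add: quadratic_weights_def \<mu>_eq)
  moreover have "non_arc_counts e m G v w"
    if "v \<in> pverts G" "w \<in> pverts G" "v \<noteq> w" "no_edge G v w" for v w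
    using \<mu> weight_mult_non_arc_iff[OF reg that m] that by (simp add: quadratic_weights_def \<mu>_eq)
  ultimately show "\<exists>e. ?R e"
    by blast
next
  assume "\<exists>e. ?R e"
  then obtain e where reg: "regular_digraph e G"
    and arcs: "\<And>v w. v \<in> pverts G \<Longrightarrow> w \<in> pverts G \<Longrightarrow> v \<rightarrow>\<^bsub>G\<^esub> w \<Longrightarrow> arc_counts e m G v w"
    and non_arcs: "\<And>v w. v \<in> pverts G \<Longrightarrow> w \<in> pverts G \<Longrightarrow> v \<noteq> w \<Longrightarrow> no_edge G v w \<Longrightarrow>
      non_arc_counts e m G v w"
    by blast
  let ?\<mu> = "real m - 1 - 3 * real e"
  have "(\<Sum>u\<in>pverts G. weight G u w) = of_real ?\<mu>" if "w \<in> pverts G" for w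
    unfolding sum_weight_eq_iff[OF that] using reg that by (simp add: regular_digraph_def m)
  moreover have "1 + (\<Sum>u\<in>pverts G. weight G v u * weight G u w) = of_real ?\<mu> * weight G v w"
    if vw: "v \<in> pverts G" "w \<in> pverts G" "v \<noteq> w" for v w
  proof -
    consider "v \<rightarrow>\<^bsub>G\<^esub> w" | "w \<rightarrow>\<^bsub>G\<^esub> v" | "no_edge G v w"
      by (auto simp: no_edge_def)
    then show ?thesis
    proof cases
      case 1
      show ?thesis
        unfolding weight_mult_arc_iff[OF reg 1 m] by (rule arcs[OF vw(1,2) 1])
    next
      \<comment> \<open>The counts are known for the pair \<open>(w, v)\<close> only; conjugation
        carries the identity over to \<open>(v, w)\<close>.\<close>
      case 2
      show ?thesis
        by (rule weight_mult_swap, unfold weight_mult_arc_iff[OF reg 2 m]) (rule arcs[OF vw(2,1) 2])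
    next
      case 3
      show ?thesis
        unfolding weight_mult_non_arc_iff[OF reg vw 3 m] by (rule non_arcs[OF vw 3])
    qed
  qed
  ultimately show ?L
    unfolding quadratic_weights_def by blast
qed

text \<open>Translates positivity of \<open>e\<close> into the existence of an arc, the graph form
  of nontriviality of the matrix.\<close>

lemma regular_digraph_pos_iff:
  assumes "regular_digraph e G" "pverts G \<noteq> {}"
  shows "e > 0 \<longleftrightarrow> parcs G \<noteq> {}"
proof -
  obtain v where v: "v \<in> pverts G"
    using assms by blast
  have "e \<noteq> 0" if "(x, y) \<in> parcs G" for x y
  proof -
    \<comment> \<open>Finiteness matters because \<open>card\<close> is 0 on infinite sets, so a
      member alone would not make the degree positive.\<close>
    have "finite (out_arcs G x)" "(x, y) \<in> out_arcs G x"
      using that pair_finite_arcs by (auto simp: out_arcs_def)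
    then have "out_degree G x \<noteq> 0"
      unfolding out_degree_def card_0_eq[OF \<open>finite (out_arcs G x)\<close>] by blast
    then show ?thesis
      using assms in_arcsD1[OF that] by (auto simp: regular_digraph_def)
  qed
  moreover have "e = 0" if "parcs G = {}"
    using assms v that by (auto simp: regular_digraph_def out_degree_def out_arcs_def)
  ultimately show ?thesis
    by auto
qed

end


section \<open>The matrix of weights\<close>

lemma mat_adjoint_index:
  assumes "(Q :: complex mat) \<in> carrier_mat n n" "i < n" "j < n"
  shows "mat_adjoint Q $$ (i, j) = cnj (Q $$ (j, i))"
  using assms by (simp add: mat_adjoint_def mat_of_rows_def)

lemma self_adjoint_iff:
  assumes "Q \<in> carrier_mat n n"
  shows "self_adjoint Q \<longleftrightarrow> (\<forall>i<n. \<forall>j<n. cnj (Q $$ (j, i)) = Q $$ (i, j))"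
proof -
  have "mat_adjoint Q \<in> carrier_mat n n"
    using assms by (auto simp: mat_adjoint_def mat_of_rows_def)
  then show ?thesis
    using assms by (auto simp: self_adjoint_def mat_eq_iff mat_adjoint_index[OF assms])
qed

text \<open>A diagonal entry of the square is a sum of squared moduli, namely \<open>n - 1\<close>
  ones and a zero, while \<open>\<mu> * Q $$ (i, i)\<close> is 0. Hence only off-diagonal entries
  impose a condition.\<close>

lemma quadratic_mat_iff:
  assumes Q: "Q \<in> carrier_mat n n" "zero_diagonal Q" "unimodular_off_diagonal Q" "self_adjoint Q"
  shows "Q ^\<^sub>m 2 = complex_of_real (real n - 1) \<cdot>\<^sub>m 1\<^sub>m n + complex_of_real \<mu> \<cdot>\<^sub>m Q \<longleftrightarrow>
    (\<forall>i<n. \<forall>j<n. i \<noteq> j \<longrightarrow>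
       (\<Sum>k\<in>{0..<n}. Q $$ (i, k) * Q $$ (k, j)) = of_real \<mu> * Q $$ (i, j))"
proof -
  have square: "(Q ^\<^sub>m 2) $$ (i, j) = (\<Sum>k\<in>{0..<n}. Q $$ (i, k) * Q $$ (k, j))"
    if "i < n" "j < n" for i j
    using Q(1) that by (simp add: numeral_2_eq_2 scalar_prod_def)
  have diag: "(\<Sum>k\<in>{0..<n}. Q $$ (i, k) * Q $$ (k, i)) = of_real (real n - 1)" if "i < n" for i
  proof -
    have norm: "Q $$ (i, k) * Q $$ (k, i) = (if k = i then 0 else 1)" if "k < n" for k
    proof (cases "k = i")
      case False
      then have "Q $$ (k, i) = cnj (Q $$ (i, k))" "cmod (Q $$ (i, k)) = 1"
        using Q \<open>i < n\<close> that by (auto simp: self_adjoint_iff[OF Q(1)] unimodular_off_diagonal_def)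
      then show ?thesis
        using False by (simp add: complex_norm_square[symmetric])
    qed (use Q \<open>i < n\<close> in \<open>auto simp: zero_diagonal_def\<close>)
    have "(\<Sum>k\<in>{0..<n}. Q $$ (i, k) * Q $$ (k, i)) = (\<Sum>k\<in>{0..<n}. 1 - (if k = i then 1 else 0))"
      using norm by (intro sum.cong) auto
    also have "\<dots> = of_real (real n - 1)"
      unfolding sum_subtractf using that by simp
    finally show ?thesis .
  qed
  have "Q ^\<^sub>m 2 = complex_of_real (real n - 1) \<cdot>\<^sub>m 1\<^sub>m n + complex_of_real \<mu> \<cdot>\<^sub>m Q \<longleftrightarrow>
    (\<forall>i<n. \<forall>j<n. (\<Sum>k\<in>{0..<n}. Q $$ (i, k) * Q $$ (k, j)) =
       (if i = j then of_real (real n - 1) else 0) + of_real \<mu> * Q $$ (i, j))"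
    using Q(1) by (auto simp: mat_eq_iff square)
  also have "\<dots> \<longleftrightarrow> (\<forall>i<n. \<forall>j<n. i \<noteq> j \<longrightarrow>
       (\<Sum>k\<in>{0..<n}. Q $$ (i, k) * Q $$ (k, j)) = of_real \<mu> * Q $$ (i, j))"
  proof -
    have "Q $$ (i, i) = 0" if "i < n" for i
      using Q that by (auto simp: zero_diagonal_def)
    then show ?thesis
      using diag by auto
  qed
  finally show ?thesis .
qed

text \<open>Indices \<open>1, \<dots>, m\<close> are the vertices, enumerated by \<open>g\<close>; index 0 is the bordering row and column.\<close>

definition weight_mat :: "nat \<Rightarrow> (nat \<Rightarrow> 'a) \<Rightarrow> 'a pair_pre_digraph \<Rightarrow> complex mat" where
  "weight_mat m g G = mat (Suc m) (Suc m)
     (\<lambda>(i, j). if i = j then 0 else if i = 0 \<or> j = 0 then 1 else weight G (g i) (g j))"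

lemma weight_mat_carrier: "weight_mat m g G \<in> carrier_mat (Suc m) (Suc m)"
  by (simp add: weight_mat_def)

section \<open>The bordered matrix of an enumerated graph\<close>

context oriented_digraph
begin

context
  fixes g :: "nat \<Rightarrow> 'a" and m :: nat
  assumes bij: "bij_betw g {1..m} (pverts G)"
begin

lemma enum_inj: "i \<in> {1..m} \<Longrightarrow> j \<in> {1..m} \<Longrightarrow> g i = g j \<longleftrightarrow> i = j"
  by (rule inj_on_eq_iff[OF bij_betw_imp_inj_on[OF bij]])

lemma weight_mat_index:
  assumes "i \<in> {1..m}" "j \<in> {1..m}"
  shows "weight_mat m g G $$ (i, j) = weight G (g i) (g j)"
  using assms by (auto simp: weight_mat_def weight_def)

lemma weight_mat_border:
  assumes "i \<in> {1..m}"
  shows "weight_mat m g G $$ (0, i) = 1" "weight_mat m g G $$ (i, 0) = 1"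
  using assms by (auto simp: weight_mat_def)

lemma weight_mat_cube_root: "cube_root_off_diagonal (weight_mat m g G)"
  by (auto simp: cube_root_off_diagonal_def weight_mat_def weight_def enum_inj omega_cube)

text \<open>Unimodularity follows from the cube root property: a nonnegative real with cube 1 is
  1.\<close>

lemma weight_mat_standard_form: "standard_form (weight_mat m g G)"
proof -
  have "cmod z = 1" if "z ^ 3 = 1" for z
  proof -
    have "cmod z ^ 3 = 1"
      using that by (metis norm_power norm_one)
    then show ?thesis
      using power_eq_imp_eq_base[of "cmod z" 3 1] by simp
  qed
  then have "unimodular_off_diagonal (weight_mat m g G)"
    using weight_mat_cube_root
    by (simp add: cube_root_off_diagonal_def unimodular_off_diagonal_def)
  then show ?thesis
    by (auto simp: standard_form_def zero_diagonal_def weight_mat_def)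
qed

lemma weight_mat_self_adjoint: "self_adjoint (weight_mat m g G)"
  unfolding self_adjoint_iff[OF weight_mat_carrier] by (auto simp: weight_mat_def cnj_weight)

text \<open>The border consists of ones, so an off-diagonal entry other than 1 lies inside it and
  comes from an arc in one of the two orders. Conversely an arc gives an entry
  \<open>\<omega>\<close>.\<close>

lemma weight_mat_nontrivial_iff: "nontrivial (weight_mat m g G) \<longleftrightarrow> parcs G \<noteq> {}"
proof
  assume "nontrivial (weight_mat m g G)"
  then show "parcs G \<noteq> {}"
    by (auto simp: nontrivial_def weight_mat_def weight_def enum_inj split: if_splits)
next
  assume "parcs G \<noteq> {}"
  then obtain x y where xy: "(x, y) \<in> parcs G"
    by auto
  then obtain i j where ij: "i \<in> {1..m}" "j \<in> {1..m}" "x = g i" "y = g j"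
    using in_arcsD1[OF xy] in_arcsD2[OF xy] bij unfolding bij_betw_def by blast
  have "weight_mat m g G $$ (i, j) = \<omega>" "i \<noteq> j"
    unfolding weight_mat_index[OF ij(1,2)]
    using xy arc_neq[of x y] by (auto simp: ij weight_def)
  then show "nontrivial (weight_mat m g G)"
    unfolding nontrivial_def using ij omega_neq(2)
    by (intro exI[of _ i] exI[of _ j] conjI) (auto simp: weight_mat_def)
qed

text \<open>Splits off the bordering index 0 both from the entry position and from the summation. In
  border entries the term \<open>k = 0\<close> vanishes; in inner entries it equals 1.\<close>

lemma weight_mat_quadratic_iff:
  "weight_mat m g G ^\<^sub>m 2 = complex_of_real (real (Suc m) - 1) \<cdot>\<^sub>m 1\<^sub>m (Suc m)
      + complex_of_real \<mu> \<cdot>\<^sub>m weight_mat m g G \<longleftrightarrow> quadratic_weights G \<mu>"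
proof -
  let ?Q = "weight_mat m g G"
  let ?P = "\<lambda>i j. (\<Sum>k\<in>{0..<Suc m}. ?Q $$ (i, k) * ?Q $$ (k, j)) = of_real \<mu> * ?Q $$ (i, j)"
  have range: "{0..<Suc m} = insert 0 {1..m}"
    by auto
  have ball_verts: "(\<forall>v\<in>pverts G. R v) \<longleftrightarrow> (\<forall>i\<in>{1..m}. R (g i))" for R
    unfolding bij_betw_imp_surj_on[OF bij, symmetric] by simp
  have reindex: "(\<Sum>k\<in>{1..m}. f (g k)) = (\<Sum>u\<in>pverts G. f u)" for f :: "'a \<Rightarrow> complex"
    by (rule sum.reindex_bij_betw[OF bij])
  have Q00: "?Q $$ (0, 0) = 0"
    by (simp add: weight_mat_def)
  have split: "(\<Sum>k\<in>{0..<Suc m}. f k) = f 0 + (\<Sum>k\<in>{1..m}. f k)" for f :: "nat \<Rightarrow> complex"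
    unfolding range by (subst sum.insert) auto
  have P0j: "?P 0 j \<longleftrightarrow> (\<Sum>u\<in>pverts G. weight G u (g j)) = of_real \<mu>" if "j \<in> {1..m}" for j
    unfolding split using that reindex[of "\<lambda>u. weight G u (g j)"]
    by (simp add: Q00 weight_mat_border weight_mat_index)
  have Pi0: "?P i 0 \<longleftrightarrow> (\<Sum>u\<in>pverts G. weight G (g i) u) = of_real \<mu>" if "i \<in> {1..m}" for i
    unfolding split using that reindex[of "\<lambda>u. weight G (g i) u"]
    by (simp add: Q00 weight_mat_border weight_mat_index)
  \<comment> \<open>Row and column sums at a vertex are conjugate and \<mu> is real, so the
    bordering column repeats the condition of the bordering row.\<close>
  have cnj_sum: "(\<Sum>u\<in>pverts G. weight G v u) = of_real \<mu> \<longleftrightarrow> (\<Sum>u\<in>pverts G. weight G u v) = of_real \<mu>"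
    for v
  proof -
    have "(\<Sum>u\<in>pverts G. weight G v u) = cnj (\<Sum>u\<in>pverts G. weight G u v)"
      by (simp add: cnj_weight)
    then show ?thesis
      by (metis complex_cnj_cnj complex_cnj_complex_of_real)
  qed
  have Pij: "?P i j \<longleftrightarrow> 1 + (\<Sum>u\<in>pverts G. weight G (g i) u * weight G u (g j))
      = of_real \<mu> * weight G (g i) (g j)" if "i \<in> {1..m}" "j \<in> {1..m}" for i j
    unfolding split using that reindex[of "\<lambda>u. weight G (g i) u * weight G u (g j)"]
    by (simp add: weight_mat_border weight_mat_index)
  have "?Q ^\<^sub>m 2 = complex_of_real (real (Suc m) - 1) \<cdot>\<^sub>m 1\<^sub>m (Suc m) + complex_of_real \<mu> \<cdot>\<^sub>m ?Q \<longleftrightarrow>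
      (\<forall>i\<in>{0..<Suc m}. \<forall>j\<in>{0..<Suc m}. i \<noteq> j \<longrightarrow> ?P i j)"
    by (subst quadratic_mat_iff[OF weight_mat_carrier])
      (use weight_mat_standard_form weight_mat_self_adjoint in \<open>auto simp: standard_form_def\<close>)
  also have "\<dots> \<longleftrightarrow> (\<forall>j\<in>{1..m}. ?P 0 j) \<and> (\<forall>i\<in>{1..m}. ?P i 0) \<and>
      (\<forall>i\<in>{1..m}. \<forall>j\<in>{1..m}. i \<noteq> j \<longrightarrow> ?P i j)"
    unfolding range ball_simps by auto
  also have "\<dots> \<longleftrightarrow> (\<forall>j\<in>{1..m}. (\<Sum>u\<in>pverts G. weight G u (g j)) = of_real \<mu>) \<and>
      (\<forall>i\<in>{1..m}. \<forall>j\<in>{1..m}. i \<noteq> j \<longrightarrow>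
         1 + (\<Sum>u\<in>pverts G. weight G (g i) u * weight G u (g j)) = of_real \<mu> * weight G (g i) (g j))"
    \<comment> \<open>After rewriting, the first two conjuncts coincide and
      \<open>conj_left_absorb\<close> merges them.\<close>
    by (simp only: P0j Pi0 Pij cnj_sum conj_left_absorb cong: ball_cong)
  also have "\<dots> \<longleftrightarrow> quadratic_weights G \<mu>"
    unfolding quadratic_weights_def ball_verts by (simp only: enum_inj cong: ball_cong)
  finally show ?thesis .
qed

end

end

section \<open>Recovering the graph from the matrix\<close>

lemma weight_mat_exists:
  assumes Q: "Q \<in> carrier_mat (Suc m) (Suc m)" "standard_form Q" "self_adjoint Q"
    "cube_root_off_diagonal Q"
  obtains G :: "nat pair_pre_digraph"
  where "oriented_digraph G" "pverts G = {1..m}" "Q = weight_mat m id G"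
proof
  \<comment> \<open>The vertices are the inner row indices themselves, so the enumeration is
    \<open>id\<close>. Only entries \<open>\<omega>\<close> give arcs; an entry
    \<open>- 1 - \<omega>\<close> is the conjugate of an \<open>\<omega>\<close> at the transposed
    position and records the reverse arc.\<close>
  define G where "G = \<lparr>pverts = {1..m}, parcs = {(i, j) \<in> {1..m} \<times> {1..m}. Q $$ (i, j) = \<omega>}\<rparr>"
  have diag: "Q $$ (i, i) = 0" if "i \<le> m" for i
    using Q that by (auto simp: standard_form_def zero_diagonal_def)
  have border: "Q $$ (0, i) = 1" "Q $$ (i, 0) = 1" if "i \<in> {1..m}" for i
    using Q that by (auto simp: standard_form_def)
  have adj: "Q $$ (j, i) = cnj (Q $$ (i, j))" if "i \<in> {1..m}" "j \<in> {1..m}" for i j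
    using Q(3) that by (auto simp: self_adjoint_iff[OF Q(1)])
  have cases: "Q $$ (i, j) = 1 \<or> Q $$ (i, j) = \<omega> \<or> Q $$ (i, j) = - 1 - \<omega>"
    if "i \<in> {1..m}" "j \<in> {1..m}" "i \<noteq> j" for i j
    using Q(1,4) that by (intro cube_root_of_unity_cases) (auto simp: cube_root_off_diagonal_def)
  show "pverts G = {1..m}"
    by (simp add: G_def)
  have "finite (parcs G)"
    by (rule finite_subset[of _ "{1..m} \<times> {1..m}"]) (auto simp: G_def)
  show "oriented_digraph G"
  proof unfold_locales
    show "fst e \<in> pverts G" "snd e \<in> pverts G" if "e \<in> parcs G" for e
      using that by (auto simp: G_def)
    show "finite (pverts G)"
      by (simp add: G_def)
    show "finite (parcs G)"
      by fact
    show "fst e \<noteq> snd e" if "e \<in> parcs G" for e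
      using that diag[of "fst e"] omega_neq(1) by (auto simp: G_def)
    show "(w, v) \<notin> parcs G" if "(v, w) \<in> parcs G" for v w
    proof -
      have vw: "v \<in> {1..m}" "w \<in> {1..m}" "Q $$ (v, w) = \<omega>"
        using that by (auto simp: G_def)
      have "Q $$ (w, v) \<noteq> \<omega>"
        unfolding adj[OF vw(1,2)] vw(3) cnj_omega using omega_neq(3) by simp
      then show ?thesis
        by (simp add: G_def)
    qed
  qed
  have inner: "Q $$ (i, j) = weight G i j" if ij: "i \<in> {1..m}" "j \<in> {1..m}" for i j
  proof (cases "i = j")
    case True
    then show ?thesis
      using diag[of i] ij by (simp add: weight_def)
  next
    case False
    then show ?thesis
      using cases[OF ij False] ij omega_neq by (auto simp: weight_def G_def adj[OF ij] cnj_omega)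
  qed
  show "Q = weight_mat m id G"
  proof (rule eq_matI)
    fix i j assume "i < dim_row (weight_mat m id G)" "j < dim_col (weight_mat m id G)"
    then have ij: "i \<le> m" "j \<le> m"
      by (simp_all add: weight_mat_def)
    then show "Q $$ (i, j) = weight_mat m id G $$ (i, j)"
      using diag[of i] border(1)[of j] border(2)[of i] inner[of i j]
      by (auto simp: weight_mat_def)
  qed (use Q(1) in \<open>simp_all add: weight_mat_def\<close>)
qed

section \<open>Equivalence of matrices and graphs\<close>

theorem theorem5p2:
  fixes n m :: nat
  assumes "n \<ge> 2" and "m = n - 1"
  shows
    "(\<exists>(\<mu>::real) (Q::complex mat).
        Q \<in> carrier_mat n n \<and> standard_form Q \<and> nontrivial Q \<and> self_adjoint Q \<and>
        cube_root_off_diagonal Q \<and>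
        Q ^\<^sub>m 2 = complex_of_real (real n - 1) \<cdot>\<^sub>m 1\<^sub>m n + complex_of_real \<mu> \<cdot>\<^sub>m Q)
     \<longleftrightarrow>
     (\<exists>(e::nat) (G::nat pair_pre_digraph).
        e > 0 \<and> oriented_digraph G \<and> pverts G \<noteq> {} \<and> card (pverts G) = m \<and>
        regular_digraph e G \<and>
        (\<forall>v\<in>pverts G. \<forall>w\<in>pverts G. v \<rightarrow>\<^bsub>G\<^esub> w \<longrightarrow>
          real (cnt_alpha G v w) - real (cnt_B G v w) = (6 * real e + 1 - 2 * real m) / 3 \<and>
          real (cnt_beta G v w) - real (cnt_C1 G v w) = (6 * real e - 2 * real m + 1) / 3 \<and>
          real (cnt_gamma G v w) + real (cnt_B G v w) + real (cnt_C1 G v w) = (4 * real m - 9 * real e - 5) / 3 \<and>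
          real (cnt_a G v w) - real (cnt_C1 G v w) = (3 * real e - real m + 2) / 3 \<and>
          real (cnt_b G v w) + real (cnt_B G v w) + real (cnt_C1 G v w) = (2 * real m - 3 * real e - 4) / 3 \<and>
          real (cnt_c G v w) - real (cnt_B G v w) = (3 * real e - real m + 2) / 3 \<and>
          real (cnt_A G v w) + real (cnt_B G v w) + real (cnt_C1 G v w) = real m - 2 * real e - 1) \<and>
        (\<forall>v\<in>pverts G. \<forall>w\<in>pverts G. v \<noteq> w \<and> no_edge G v w \<longrightarrow>
          real (cnt_alpha G v w) = real (cnt_B G v w) \<and>
          real (cnt_beta G v w) = real (cnt_C1 G v w) + 3 * real e + 2 - real m \<and>
          real (cnt_gamma G v w) = real m - 2 * real e - 2 - real (cnt_B G v w) - real (cnt_C1 G v w) \<and>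
          real (cnt_a G v w) = real (cnt_C1 G v w) + 3 * real e + 2 - real m \<and>
          real (cnt_b G v w) = real m - 2 * real e - 2 - real (cnt_B G v w) - real (cnt_C1 G v w) \<and>
          real (cnt_c G v w) = real (cnt_B G v w) \<and>
          real (cnt_A G v w) = real m - 2 * real e - 2 - real (cnt_B G v w) - real (cnt_C1 G v w)))"
proof -
  have n: "n = Suc m"
    using assms by simp
  define R where "R e G \<longleftrightarrow> regular_digraph e G \<and>
      (\<forall>v\<in>pverts G. \<forall>w\<in>pverts G. v \<rightarrow>\<^bsub>G\<^esub> w \<longrightarrow> arc_counts e m G v w) \<and>
      (\<forall>v\<in>pverts G. \<forall>w\<in>pverts G. v \<noteq> w \<and> no_edge G v w \<longrightarrow> non_arc_counts e m G v w)"
    for e and G :: "nat pair_pre_digraph"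
  \<comment> \<open>The intermediate statement does not mention \<open>e\<close>: the graph has an
    arc and its weights satisfy the quadratic relations for some \<mu>.\<close>
  have "(\<exists>\<mu> Q. Q \<in> carrier_mat n n \<and> standard_form Q \<and> nontrivial Q \<and> self_adjoint Q \<and>
        cube_root_off_diagonal Q \<and>
        Q ^\<^sub>m 2 = complex_of_real (real n - 1) \<cdot>\<^sub>m 1\<^sub>m n + complex_of_real \<mu> \<cdot>\<^sub>m Q)
     \<longleftrightarrow> (\<exists>G :: nat pair_pre_digraph. oriented_digraph G \<and> pverts G \<noteq> {} \<and> card (pverts G) = m \<and>
            parcs G \<noteq> {} \<and> (\<exists>\<mu>. quadratic_weights G \<mu>))" (is "?L \<longleftrightarrow> ?M")
  proof
    assume ?L
    then obtain \<mu> Q where Q: "Q \<in> carrier_mat (Suc m) (Suc m)" "standard_form Q" "nontrivial Q"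
      "self_adjoint Q" "cube_root_off_diagonal Q"
      "Q ^\<^sub>m 2 = complex_of_real (real (Suc m) - 1) \<cdot>\<^sub>m 1\<^sub>m (Suc m) + complex_of_real \<mu> \<cdot>\<^sub>m Q"
      unfolding n by blast
    obtain G :: "nat pair_pre_digraph"
      where G: "oriented_digraph G" "pverts G = {1..m}" "Q = weight_mat m id G"
      using weight_mat_exists[OF Q(1,2,4,5)] .
    interpret oriented_digraph G
      by (rule G(1))
    have bij: "bij_betw id {1..m} (pverts G)"
      by (simp add: G(2))
    have "parcs G \<noteq> {}" "quadratic_weights G \<mu>"
      using Q(3,6) weight_mat_nontrivial_iff[OF bij] weight_mat_quadratic_iff[OF bij]
      by (simp_all only: G(3) simp_thms)
    \<comment> \<open>From \<open>n \<ge> 2\<close> follows \<open>m \<ge> 1\<close>, so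
      \<open>{1..m}\<close> is nonempty.\<close>
    moreover have "pverts G \<noteq> {}" "card (pverts G) = m"
      using assms by (auto simp: G(2))
    ultimately show ?M
      using G(1) by blast
  next
    assume ?M
    then obtain G :: "nat pair_pre_digraph" and \<mu> where G: "oriented_digraph G"
      "card (pverts G) = m" "parcs G \<noteq> {}" "quadratic_weights G \<mu>"
      by blast
    interpret oriented_digraph G
      by (rule G(1))
    \<comment> \<open>The vertices of the given graph are arbitrary naturals; equal cardinality
      supplies the numbering of rows and columns.\<close>
    obtain g where bij: "bij_betw g {1..m} (pverts G)"
      using finite_same_card_bij[of "{1..m}" "pverts G"] pair_finite_verts G(2) by auto
    show ?L
      unfolding n using weight_mat_carrier weight_mat_standard_form[OF bij]
        weight_mat_self_adjoint[OF bij] weight_mat_cube_root[OF bij]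
        weight_mat_nontrivial_iff[OF bij] weight_mat_quadratic_iff[OF bij] G(3,4) by blast
  qed
  also have "\<dots> \<longleftrightarrow> (\<exists>e G. e > 0 \<and> oriented_digraph G \<and> pverts G \<noteq> {} \<and> card (pverts G) = m \<and> R e G)"
  proof -
    have "parcs G \<noteq> {} \<and> (\<exists>\<mu>. quadratic_weights G \<mu>) \<longleftrightarrow> (\<exists>e. e > 0 \<and> R e G)"
      if G: "oriented_digraph G" "pverts G \<noteq> {}" "card (pverts G) = m" for G
    proof -
      interpret oriented_digraph G
        by (rule G(1))
      have "R e G \<Longrightarrow> e > 0 \<longleftrightarrow> parcs G \<noteq> {}" for e
        unfolding R_def using regular_digraph_pos_iff G(2) by blast
      then show ?thesis
        unfolding quadratic_weights_iff[OF G(3)[symmetric] G(2)] R_def[symmetric] by blast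
    qed
    then show ?thesis
      by metis
  qed
  finally show ?thesis
    unfolding R_def arc_counts_def non_arc_counts_def .
qed

end
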